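(* Let $\rho=\sum_{i=1}^4\lambda_i\Pi_i$ and $\rho'=\sum_{i=1}^4\lambda'_i\Pi_i$ be two entangled two-qubit Bell-diagonal states whose weight vectors $\vec\lambda=(\lambda_1,\lambda_2,\lambda_3,\lambda_4)$ and $\vec\lambda'=(\lambda'_1,\lambda'_2,\lambda'_3,\lambda'_4)$ satisfy $\lambda_1\ge\lambda_2\ge\lambda_3\ge\lambda_4$ and $\lambda'_1\ge\lambda'_2\ge\lambda'_3\ge\lambda'_4$. Define $$E_1(\vec\lambda)=\lambda_1,\qquad E_2(\vec\lambda)=\frac{1-2\lambda_2}{\lambda_3+\lambda_4},\qquad E_3(\vec\lambda)=\frac{1-2\lambda_2-2\lambda_3}{\lambda_4},$$ with the convention $c/0=+\infty$ for $c>0$. Then $\rho$ can be transformed into $\rho'$ by SLOCC if and only if $E_k(\vec\lambda)\ge E_k(\vec\lambda')$ for $k=1,2,3$.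
   Context: Bell basis: $|\Phi_{1,2}\rangle=\frac{1}{\sqrt2}(|00\rangle\pm|11\rangle)$, $|\Phi_{3,4}\rangle=\frac{1}{\sqrt2}(|01\rangle\pm|10\rangle)$, $\Pi_i=|\Phi_i\rangle\langle\Phi_i|$; a Bell-diagonal state is $\sum_i\lambda_i\Pi_i$ with $\lambda_i\ge0$, $\sum_i\lambda_i=1$. A two-qubit state is entangled if it is not separable (not a convex combination of product states). A state $\rho$ can be transformed into $\rho'$ by SLOCC (stochastic local operations and classical communication) if there exist finitely many $2\times2$ matrices $A_i,B_i$ such that $\sum_i (A_i\otimes B_i)\rho(A_i\otimes B_i)^\dagger=c\,\rho'$ for some $c>0$. *)

theory Defs
  imports "HOL-Analysis.Analysis" "HOL-Library.Extended_Real"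
begin

text \<open>Single-qubit operators: complex^2^2. Two-qubit operators: complex^(2*2)^(2*2),
 where the index (a,b) stands for the computational basis vector |ab>.\<close>

type_synonym qop = "complex ^ 2 ^ 2"
type_synonym qvec2 = "complex ^ (2 \<times> 2)"
type_synonym qop2 = "complex ^ (2 \<times> 2) ^ (2 \<times> 2)"

definition kron :: "qop \<Rightarrow> qop \<Rightarrow> qop2" where
  "kron A B = (\<chi> ij kl. A $ fst ij $ fst kl * B $ snd ij $ snd kl)"

definition cadj :: "complex ^ 'n ^ 'm \<Rightarrow> complex ^ 'm ^ 'n" where
  "cadj M = (\<chi> i j. cnj (M $ j $ i))"

definition hermitian :: "complex ^ 'n ^ 'n \<Rightarrow> bool" where
  "hermitian M \<longleftrightarrow> cadj M = M"

definition psd :: "complex ^ 'n ^ 'n \<Rightarrow> bool" where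
  "psd M \<longleftrightarrow> hermitian M \<and>
     (\<forall>x. let q = (\<Sum>i\<in>UNIV. cnj (x $ i) * (M *v x) $ i) in Im q = 0 \<and> Re q \<ge> 0)"

definition trace_c :: "complex ^ 'n ^ 'n \<Rightarrow> complex" where
  "trace_c M = (\<Sum>i\<in>UNIV. M $ i $ i)"

definition density :: "complex ^ 'n ^ 'n \<Rightarrow> bool" where
  "density M \<longleftrightarrow> psd M \<and> trace_c M = 1"

definition separable :: "qop2 \<Rightarrow> bool" where
  "separable \<rho> \<longleftrightarrow> (\<exists>(n::nat) (p::nat \<Rightarrow> real) (sA::nat \<Rightarrow> qop) (sB::nat \<Rightarrow> qop).
     (\<forall>i<n. p i \<ge> 0 \<and> density (sA i) \<and> density (sB i)) \<and> (\<Sum>i<n. p i) = 1 \<and>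
     \<rho> = (\<Sum>i<n. p i *\<^sub>R kron (sA i) (sB i)))"

definition entangled :: "qop2 \<Rightarrow> bool" where
  "entangled \<rho> \<longleftrightarrow> density \<rho> \<and> \<not> separable \<rho>"

definition slocc :: "qop2 \<Rightarrow> qop2 \<Rightarrow> bool" where
  "slocc \<rho> \<rho>' \<longleftrightarrow> (\<exists>(n::nat) (A::nat \<Rightarrow> qop) (B::nat \<Rightarrow> qop) (c::real). c > 0 \<and>
     (\<Sum>i<n. kron (A i) (B i) ** \<rho> ** cadj (kron (A i) (B i))) = c *\<^sub>R \<rho>')"

definition ket :: "2 \<Rightarrow> 2 \<Rightarrow> qvec2" where
  "ket a b = (\<chi> ij. if ij = (a, b) then 1 else 0)"

definition bell :: "nat \<Rightarrow> qvec2" where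
  "bell k = (if k = 1 then complex_of_real (1 / sqrt 2) *s (ket 0 0 + ket 1 1)
        else if k = 2 then complex_of_real (1 / sqrt 2) *s (ket 0 0 - ket 1 1)
        else if k = 3 then complex_of_real (1 / sqrt 2) *s (ket 0 1 + ket 1 0)
        else complex_of_real (1 / sqrt 2) *s (ket 0 1 - ket 1 0))"

definition proj :: "qvec2 \<Rightarrow> qop2" where
  "proj v = (\<chi> i j. v $ i * cnj (v $ j))"

definition bell_diag :: "(nat \<Rightarrow> real) \<Rightarrow> qop2" where
  "bell_diag lam = (\<Sum>i\<in>{1..4}. lam i *\<^sub>R proj (bell i))"

text \<open>Division into the extended reals with the convention c/0 = +infinity for c > 0
 (the value for c \<le> 0 and zero denominator is never used for entangled states).\<close>
definition ediv :: "real \<Rightarrow> real \<Rightarrow> ereal" where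
  "ediv a b = (if b = 0 then (if a > 0 then \<infinity> else ereal 0) else ereal (a / b))"

definition E1 :: "(nat \<Rightarrow> real) \<Rightarrow> ereal" where "E1 lam = ereal (lam 1)"
definition E2 :: "(nat \<Rightarrow> real) \<Rightarrow> ereal" where
  "E2 lam = ediv (1 - 2 * lam 2) (lam 3 + lam 4)"
definition E3 :: "(nat \<Rightarrow> real) \<Rightarrow> ereal" where
  "E3 lam = ediv (1 - 2 * lam 2 - 2 * lam 3) (lam 4)"

end

(*
  Put D = l1 - l2 - l3 - l4, which is positive for entangled states, since otherwise the state is a
  mixture of the separable states with weights (1,1,0,0)/2 up to permutation. The three conditions
  then say that S/D does not decrease for S = l2+l3+l4, l3+l4, l4 when passing to the target.

  Necessity: in the Bell basis with suitable phases, A (x) B is a complex 4x4 matrix U with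
  U U^T = U^T U = d I, where d = det A det B. Isotropic vectors give bounds on partial sums of the
  |U_ji|^2, showing that D is multiplied by at most |d| while l4, l3+l4 and the trace are
  multiplied by at least |d|.

  Sufficiency: rescale the source so that its D becomes that of the target. The conditions then say
  that (l2',l3',l4') weakly majorizes from above the rescaled (l2,l3,l4), hence dominates a mixture
  of its permutations, and the rest is supplied by separable states produced by local filtering.
*)
theory Submission
  imports Defs
begin

section \<open>Local operations and the Bell basis\<close>

text \<open>Numerals of type \<open>2\<close> wrap around modulo 2, so the index 2 of
  \<open>forall_2\<close>, \<open>sum_2\<close> and \<open>det_2\<close> is the index 0 used
  here.\<close>

lemma two_eq_zero: "(2::2) = 0" by simp

lemma all_two_zero_one: "(\<forall>i::2. P i) \<longleftrightarrow> P 0 \<and> P 1"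
  using forall_2[of P] two_eq_zero by metis

lemma vec_pair_eq_iff:
  "(v :: 'a ^ (2 \<times> 2)) = w \<longleftrightarrow> v$(0,0) = w$(0,0) \<and> v$(0,1) = w$(0,1) \<and> v$(1,0) = w$(1,0) \<and> v$(1,1) = w$(1,1)"
  by (auto simp: vec_eq_iff all_two_zero_one)

lemma sum_two_zero_one: "sum f (UNIV::2 set) = f 0 + f 1"
  using sum_2[of f] by (simp only: two_eq_zero add.commute)

lemma sum_pair2: "sum f (UNIV::(2 \<times> 2) set) = f (0,0) + f (0,1) + f (1,0) + f (1,1)"
proof -
  have "sum f (UNIV::(2 \<times> 2) set) = (\<Sum>i\<in>UNIV. \<Sum>j\<in>UNIV. f (i,j))"
    by (simp add: sum.cartesian_product flip: UNIV_Times_UNIV)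
  then show ?thesis by (simp add: sum_two_zero_one add.assoc)
qed

definition local_op :: "qop \<Rightarrow> qop \<Rightarrow> qop2 \<Rightarrow> qop2" where
  "local_op A B X = kron A B ** X ** cadj (kron A B)"

lemma kron_mult: "kron A B ** kron A' B' = kron (A ** A') (B ** B')"
  by (simp add: vec_eq_iff kron_def matrix_matrix_mult_def sum_pair2 sum_two_zero_one algebra_simps)

lemma cadj_mult: "cadj (M ** N) = cadj N ** cadj M"
  by (simp add: vec_eq_iff cadj_def matrix_matrix_mult_def mult.commute)

lemma local_op_local_op: "local_op A B (local_op A' B' X) = local_op (A ** A') (B ** B') X"
  by (simp add: local_op_def kron_mult[symmetric] cadj_mult matrix_mul_assoc)

lemma local_op_add: "local_op A B (X + Y) = local_op A B X + local_op A B Y"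
  by (simp add: vec_eq_iff local_op_def matrix_matrix_mult_def sum_pair2 algebra_simps)

lemma local_op_sum: "local_op A B (\<Sum>i\<in>I. f i) = (\<Sum>i\<in>I. local_op A B (f i))"
proof (induction I rule: infinite_finite_induct)
qed (simp_all add: local_op_add, simp_all add: local_op_def)

lemma local_op_scaleR: "local_op A B (r *\<^sub>R X) = r *\<^sub>R local_op A B X"
  by (simp add: vec_eq_iff local_op_def matrix_matrix_mult_def sum_pair2 algebra_simps)

lemma local_op_proj: "local_op A B (proj v) = proj (kron A B *v v)"
  by (simp add: vec_eq_iff local_op_def cadj_def proj_def matrix_matrix_mult_def
      matrix_vector_mult_def sum_pair2 algebra_simps)

lemma proj_scale: "proj (c *s v) = (cmod c)\<^sup>2 *\<^sub>R proj v"
proof -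
  have "c * cnj c = (of_real (cmod c))\<^sup>2"
    by (metis complex_norm_square of_real_power)
  then show ?thesis
    by (simp add: vec_eq_iff proj_def scaleR_conv_of_real[of _ "_::complex"] algebra_simps)
qed

section \<open>Bell weights and the local operators acting on them\<close>

lemma atLeastAtMost_1_4: "{1..4::nat} = {1,2,3,4}" by auto

definition bdiag :: "real \<Rightarrow> real \<Rightarrow> real \<Rightarrow> real \<Rightarrow> qop2" where
  "bdiag a b c d = a *\<^sub>R proj (bell 1) + b *\<^sub>R proj (bell 2) + c *\<^sub>R proj (bell 3) + d *\<^sub>R proj (bell 4)"

lemma bell_diag_eq: "bell_diag lam = bdiag (lam 1) (lam 2) (lam 3) (lam 4)"
  unfolding bell_diag_def bdiag_def atLeastAtMost_1_4 by (simp add: add.assoc)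

definition mat2 :: "complex \<Rightarrow> complex \<Rightarrow> complex \<Rightarrow> complex \<Rightarrow> qop" where
  "mat2 a b c d = (\<chi> i j. if i = 0 then if j = 0 then a else b else if j = 0 then c else d)"

lemma mat2_nth [simp]: "mat2 a b c d $ 0 $ 0 = a" "mat2 a b c d $ 0 $ 1 = b"
  "mat2 a b c d $ 1 $ 0 = c" "mat2 a b c d $ 1 $ 1 = d"
  by (simp_all add: mat2_def)

lemma bell_nth:
  "bell (Suc 0) $ ij = (if ij = (0,0) \<or> ij = (1,1) then of_real (1 / sqrt 2) else 0)"
  "bell 2 $ ij = (if ij = (0,0) then of_real (1 / sqrt 2) else if ij = (1,1) then - of_real (1 / sqrt 2) else 0)"
  "bell 3 $ ij = (if ij = (0,1) \<or> ij = (1,0) then of_real (1 / sqrt 2) else 0)"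
  "bell 4 $ ij = (if ij = (0,1) then of_real (1 / sqrt 2) else if ij = (1,0) then - of_real (1 / sqrt 2) else 0)"
  by (auto simp: bell_def ket_def)

lemma proj_uminus: "proj (- v) = proj v"
  by (simp add: proj_def)

lemma sqrt2_mult: "complex_of_real (sqrt 2) * complex_of_real (sqrt 2) = 2"
  by (simp flip: of_real_mult)

text \<open>Opposite phase gates cancel on |00> and |11> and leave opposite phases on |01> and |10>.
  With the next two lemmas this generates all permutations of the weights: conjugating by
  \<open>local_op_swap13_24\<close> gives the exchange of 1 and 2.\<close>

lemma local_op_swap34: "local_op (mat2 1 0 0 \<i>) (mat2 1 0 0 (-\<i>)) (bdiag a b c d) = bdiag a b d c"
proof -
  let ?K = "kron (mat2 1 0 0 \<i>) (mat2 1 0 0 (-\<i>))"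
  have "?K *v bell 1 = bell 1" "?K *v bell 2 = bell 2"
    "?K *v bell 3 = (-\<i>) *s bell 4" "?K *v bell 4 = (-\<i>) *s bell 3"
    by (simp_all add: vec_pair_eq_iff kron_def matrix_vector_mult_def sum_pair2 bell_nth)
  then show ?thesis
    unfolding bdiag_def local_op_add local_op_scaleR local_op_proj by (simp add: proj_scale proj_uminus)
qed

text \<open>A Hadamard gate on each qubit exchanges phase flips with bit flips and fixes the singlet
  up to sign.\<close>

lemma local_op_swap23:
  defines "h \<equiv> of_real (1 / sqrt 2)"
  shows "local_op (mat2 h h h (-h)) (mat2 h h h (-h)) (bdiag a b c d) = bdiag a c b d"
proof -
  let ?K = "kron (mat2 h h h (-h)) (mat2 h h h (-h))"
  have h: "h * h = 1/2"
    unfolding h_def of_real_mult[symmetric] by simp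
  have "?K *v bell 1 = bell 1" "?K *v bell 2 = bell 3"
    "?K *v bell 3 = bell 2" "?K *v bell 4 = - bell 4"
    by (simp_all add: vec_pair_eq_iff kron_def matrix_vector_mult_def sum_pair2 bell_nth h h_def[symmetric])
  then show ?thesis
    unfolding bdiag_def local_op_add local_op_scaleR local_op_proj by (simp add: proj_uminus)
qed

lemma local_op_swap13_24: "local_op (mat2 0 1 1 0) (mat2 1 0 0 1) (bdiag a b c d) = bdiag c d a b"
proof -
  let ?K = "kron (mat2 0 1 1 0) (mat2 1 0 0 1)"
  have "?K *v bell 1 = bell 3" "?K *v bell 2 = - bell 4"
    "?K *v bell 3 = bell 1" "?K *v bell 4 = - bell 2"
    by (simp_all add: vec_pair_eq_iff kron_def matrix_vector_mult_def sum_pair2 bell_nth)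
  then show ?thesis
    unfolding bdiag_def local_op_add local_op_scaleR local_op_proj by (simp add: proj_uminus)
qed

text \<open>Filtering onto |00> is how a product state, and from it every separable part needed
  later, is extracted from the source.\<close>

lemma local_op_product:
  "local_op (mat2 1 0 0 0) (mat2 1 0 0 0) (bdiag a b c d) = ((a + b) / 2) *\<^sub>R proj (ket 0 0)"
proof -
  let ?K = "kron (mat2 1 0 0 0) (mat2 1 0 0 0)"
  \<comment> \<open>The two vanishing images are written as zero multiples of
    \<open>ket 0 0\<close>, so that \<open>proj_scale\<close> treats all four alike.\<close>
  have K: "?K *v bell 1 = of_real (1 / sqrt 2) *s ket 0 0" "?K *v bell 2 = of_real (1 / sqrt 2) *s ket 0 0"
    "?K *v bell 3 = 0 *s ket 0 0" "?K *v bell 4 = 0 *s ket 0 0"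
    by (simp_all add: vec_pair_eq_iff kron_def matrix_vector_mult_def sum_pair2 bell_nth ket_def)
  show ?thesis
    unfolding bdiag_def local_op_add local_op_scaleR local_op_proj K proj_scale norm_of_real
    by (simp add: power_divide add_divide_distrib flip: scaleR_left.add)
qed

lemma proj_ket_sum:
  "proj (ket 0 0) + local_op (mat2 0 1 1 0) (mat2 0 1 1 0) (proj (ket 0 0)) = bdiag 1 1 0 0"
proof -
  have K: "kron (mat2 0 1 1 0) (mat2 0 1 1 0) *v ket 0 0 = ket 1 1"
    by (simp_all add: vec_pair_eq_iff kron_def matrix_vector_mult_def sum_pair2 ket_def)
  show ?thesis
    unfolding local_op_proj K
    by (simp add: bdiag_def vec_pair_eq_iff proj_def bell_nth ket_def sqrt2_mult)
qed

section \<open>The convex cone of unnormalised operators reachable from a state\<close>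

definition reach :: "qop2 \<Rightarrow> qop2 \<Rightarrow> bool" where
  "reach \<rho> \<sigma> \<longleftrightarrow> (\<exists>(n::nat) A B. (\<Sum>i<n. local_op (A i) (B i) \<rho>) = \<sigma>)"

lemma slocc_iff_reach: "slocc \<rho> \<rho>' \<longleftrightarrow> (\<exists>c>0. reach \<rho> (c *\<^sub>R \<rho>'))"
  unfolding slocc_def reach_def local_op_def by blast

lemma local_op_mat: "local_op (mat (of_real s)) (mat 1) \<rho> = s\<^sup>2 *\<^sub>R \<rho>"
proof -
  have "kron (mat (of_real s)) (mat 1) = mat (of_real s)"
    by (auto simp: vec_eq_iff kron_def mat_def)
  moreover have "cadj (mat (of_real s) :: qop2) = mat (of_real s)"
    by (auto simp: vec_eq_iff cadj_def mat_def)
  ultimately have "local_op (mat (of_real s)) (mat 1) \<rho> = mat (of_real s) ** \<rho> ** mat (of_real s)"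
    by (simp only: local_op_def)
  then show ?thesis
    by (auto simp: vec_pair_eq_iff matrix_matrix_mult_def mat_def sum_pair2 power2_eq_square scaleR_conv_of_real[of _ "_::complex"])
qed

lemma reach_refl: "reach \<rho> \<rho>"
  unfolding reach_def
  by (rule exI[of _ 1], rule exI[of _ "\<lambda>_. mat 1"], rule exI[of _ "\<lambda>_. mat 1"])
    (use local_op_mat[of 1] in simp)

lemma reach_local_op:
  assumes "reach \<rho> \<sigma>" shows "reach \<rho> (local_op A B \<sigma>)"
proof -
  obtain n :: nat and A' B' where "(\<Sum>i<n. local_op (A' i) (B' i) \<rho>) = \<sigma>"
    using assms unfolding reach_def by blast
  then have "(\<Sum>i<n. local_op (A ** A' i) (B ** B' i) \<rho>) = local_op A B \<sigma>"
    by (auto simp: local_op_sum local_op_local_op)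
  then show ?thesis unfolding reach_def by (meson exI)
qed

lemma reach_add:
  assumes "reach \<rho> \<sigma>" "reach \<rho> \<tau>" shows "reach \<rho> (\<sigma> + \<tau>)"
proof -
  obtain n :: nat and A B where 1: "(\<Sum>i<n. local_op (A i) (B i) \<rho>) = \<sigma>"
    using assms(1) unfolding reach_def by blast
  obtain m :: nat and A' B' where 2: "(\<Sum>i<m. local_op (A' i) (B' i) \<rho>) = \<tau>"
    using assms(2) unfolding reach_def by blast
  define A'' where "A'' = (\<lambda>i. if i < n then A i else A' (i - n))"
  define B'' where "B'' = (\<lambda>i. if i < n then B i else B' (i - n))"
  \<comment> \<open>The number \<open>k\<close> of appended operators is free, so that induction
    adds the second family one term at a time.\<close>
  have "(\<Sum>i<n + k. local_op (A'' i) (B'' i) \<rho>)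
      = (\<Sum>i<n. local_op (A i) (B i) \<rho>) + (\<Sum>i<k. local_op (A' i) (B' i) \<rho>)" for k
    by (induction k) (simp_all add: A''_def B''_def add.assoc)
  from this[of m] show ?thesis unfolding reach_def 1 2 by blast
qed

lemma reach_scaleR:
  assumes "reach \<rho> \<sigma>" "r \<ge> 0" shows "reach \<rho> (r *\<^sub>R \<sigma>)"
  using reach_local_op[OF assms(1), of "mat (of_real (sqrt r))" "mat 1"] assms(2)
  by (simp add: local_op_mat)

section \<open>Complex orthogonal matrices\<close>

text \<open>An orthogonal pair \<open>a\<close>, \<open>b\<close> of equal bilinear square yields the isotropic vectors
  \<open>a \<plusminus> \<i> b\<close>; each component of an isotropic vector is dominated by the others.\<close>

lemma parallelogram_i: "(cmod (a + \<i> * b))\<^sup>2 + (cmod (a - \<i> * b))\<^sup>2 = 2 * ((cmod a)\<^sup>2 + (cmod b)\<^sup>2)"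
  by (simp add: cmod_power2) (simp add: power2_eq_square algebra_simps)

lemma norm_sum_squares_le:
  fixes z :: "nat \<Rightarrow> complex"
  shows "cmod (\<Sum>i\<in>I. (z i)\<^sup>2) \<le> (\<Sum>i\<in>I. (cmod (z i))\<^sup>2)"
  using norm_sum[of "\<lambda>i. (z i)\<^sup>2" I] by (simp add: norm_power)

text \<open>Solve the bilinear square for one term and use the triangle inequality. The bilinear
  square stays in the bound because it vanishes for isotropic vectors but equals \<open>d\<close>
  for a single column of the matrix.\<close>

lemma isotropic_component_le:
  fixes z :: "nat \<Rightarrow> complex"
  assumes "finite I" "i \<in> I"
  shows "(cmod (z i))\<^sup>2 \<le> cmod (\<Sum>i\<in>I. (z i)\<^sup>2) + (\<Sum>j\<in>I - {i}. (cmod (z j))\<^sup>2)"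
proof -
  have "(z i)\<^sup>2 = (\<Sum>i\<in>I. (z i)\<^sup>2) - (\<Sum>j\<in>I - {i}. (z j)\<^sup>2)"
    using assms by (simp add: sum.remove)
  then have "cmod ((z i)\<^sup>2) \<le> cmod (\<Sum>i\<in>I. (z i)\<^sup>2) + cmod (\<Sum>j\<in>I - {i}. (z j)\<^sup>2)"
    by (metis norm_triangle_ineq4)
  then show ?thesis
    using norm_sum_squares_le[of z "I - {i}"] by (simp add: norm_power)
qed

lemma sum_squares_isotropic:
  fixes a b :: "nat \<Rightarrow> complex"
  assumes "(\<Sum>i\<in>I. (a i)\<^sup>2) = d" "(\<Sum>i\<in>I. (b i)\<^sup>2) = d" "(\<Sum>i\<in>I. a i * b i) = 0"
  shows "(\<Sum>i\<in>I. (a i + \<i> * b i)\<^sup>2) = 0" "(\<Sum>i\<in>I. (a i - \<i> * b i)\<^sup>2) = 0"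
    "(\<Sum>i\<in>I. (a i + \<i> * b i) * (a i - \<i> * b i)) = 2 * d"
proof -
  \<comment> \<open>A general \<open>c\<close> covers both signs: for c = i and c = -i the first two
    sums cancel.\<close>
  have "(\<Sum>i\<in>I. (a i + c * b i)\<^sup>2) = (\<Sum>i\<in>I. (a i)\<^sup>2) + c\<^sup>2 * (\<Sum>i\<in>I. (b i)\<^sup>2) + 2 * c * (\<Sum>i\<in>I. a i * b i)" for c
    by (simp add: sum.distrib sum_distrib_left power2_eq_square algebra_simps)
  from this[of \<i>] this[of "-\<i>"] assms
  show "(\<Sum>i\<in>I. (a i + \<i> * b i)\<^sup>2) = 0" "(\<Sum>i\<in>I. (a i - \<i> * b i)\<^sup>2) = 0" by simp_all
  have "(\<Sum>i\<in>I. (a i + \<i> * b i) * (a i - \<i> * b i)) = (\<Sum>i\<in>I. (a i)\<^sup>2) + (\<Sum>i\<in>I. (b i)\<^sup>2)"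
    by (simp add: sum.distrib[symmetric] power2_eq_square algebra_simps)
  then show "(\<Sum>i\<in>I. (a i + \<i> * b i) * (a i - \<i> * b i)) = 2 * d" using assms by simp
qed

lemma orthogonal_pair_component_le:
  fixes a b :: "nat \<Rightarrow> complex"
  assumes "finite I" "i \<in> I"
    and "(\<Sum>i\<in>I. (a i)\<^sup>2) = d" "(\<Sum>i\<in>I. (b i)\<^sup>2) = d" "(\<Sum>i\<in>I. a i * b i) = 0"
  shows "(cmod (a i))\<^sup>2 + (cmod (b i))\<^sup>2 \<le> (\<Sum>j\<in>I - {i}. (cmod (a j))\<^sup>2 + (cmod (b j))\<^sup>2)"
proof -
  note n = sum_squares_isotropic[OF assms(3-5)]
  have "(cmod (a i + \<i> * b i))\<^sup>2 + (cmod (a i - \<i> * b i))\<^sup>2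
      \<le> (\<Sum>j\<in>I - {i}. (cmod (a j + \<i> * b j))\<^sup>2 + (cmod (a j - \<i> * b j))\<^sup>2)"
    using isotropic_component_le[OF assms(1,2), of "\<lambda>i. a i + \<i> * b i"]
      isotropic_component_le[OF assms(1,2), of "\<lambda>i. a i - \<i> * b i"] n
    by (simp add: sum.distrib)
  then show ?thesis
    unfolding parallelogram_i sum_distrib_left[symmetric] by simp
qed

text \<open>The isotropic vectors \<open>n\<close> and \<open>m\<close> have bilinear product 2d, so
  4|d| is at most their total squared length. In each of them entry \<open>i\<close> is dominated by
  the others, so that total is at most twice the part without \<open>i\<close>.\<close>

lemma orthogonal_pair_sum_ge:
  fixes a b :: "nat \<Rightarrow> complex"
  assumes "finite I" "i \<in> I"
    and "(\<Sum>i\<in>I. (a i)\<^sup>2) = d" "(\<Sum>i\<in>I. (b i)\<^sup>2) = d" "(\<Sum>i\<in>I. a i * b i) = 0"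
  shows "cmod d \<le> (\<Sum>j\<in>I - {i}. (cmod (a j))\<^sup>2 + (cmod (b j))\<^sup>2)"
proof -
  define n m where "n = (\<lambda>i. a i + \<i> * b i)" and "m = (\<lambda>i. a i - \<i> * b i)"
  have nm: "(\<Sum>j\<in>I. (n j)\<^sup>2) = 0" "(\<Sum>j\<in>I. (m j)\<^sup>2) = 0" "(\<Sum>j\<in>I. n j * m j) = 2 * d"
    using sum_squares_isotropic[OF assms(3-5)] by (simp_all add: n_def m_def)
  let ?s = "(\<Sum>j\<in>I - {i}. (cmod (n j))\<^sup>2 + (cmod (m j))\<^sup>2)"
  have prod_le: "2 * cmod (x * y) \<le> (cmod x)\<^sup>2 + (cmod y)\<^sup>2" for x y
    using sum_squares_bound[of "cmod x" "cmod y"] by (simp add: norm_mult)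
  have "(\<Sum>j\<in>I. n j * m j) = n i * m i + (\<Sum>j\<in>I - {i}. n j * m j)"
    using assms by (simp add: sum.remove)
  moreover have "cmod (\<Sum>j\<in>I. n j * m j) = 2 * cmod d"
    by (simp add: nm norm_mult)
  ultimately have "2 * cmod d \<le> cmod (n i * m i) + (\<Sum>j\<in>I - {i}. cmod (n j * m j))"
    using norm_triangle_ineq[of "n i * m i" "\<Sum>j\<in>I - {i}. n j * m j"]
      norm_sum[of "\<lambda>j. n j * m j" "I - {i}"] by (simp add: norm_mult)
  then have "4 * cmod d \<le> 2 * cmod (n i * m i) + (\<Sum>j\<in>I - {i}. 2 * cmod (n j * m j))"
    by (simp flip: sum_distrib_left)
  also have "\<dots> \<le> ((cmod (n i))\<^sup>2 + (cmod (m i))\<^sup>2) + ?s"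
    by (intro add_mono sum_mono prod_le)
  also have "(cmod (n i))\<^sup>2 + (cmod (m i))\<^sup>2 \<le> ?s"
    using isotropic_component_le[OF assms(1,2), of n] isotropic_component_le[OF assms(1,2), of m] nm
    by (simp add: sum.distrib)
  finally have "4 * cmod d \<le> 2 * ?s" by simp
  moreover have "?s = 2 * (\<Sum>j\<in>I - {i}. (cmod (a j))\<^sup>2 + (cmod (b j))\<^sup>2)"
    unfolding n_def m_def parallelogram_i sum_distrib_left ..
  ultimately show ?thesis by simp
qed

text \<open>Here \<open>\<mu>\<close> lists the new weights. Each bound is a summation by parts: the
  ordering of \<open>lam\<close> splits every quantity into nonnegative coefficients times an
  inequality for the squared moduli \<open>P\<close>.\<close>

lemma orthogonal_weights:
  fixes U :: "nat \<Rightarrow> nat \<Rightarrow> complex" and lam :: "nat \<Rightarrow> real"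
  assumes cols: "\<And>i k. i \<in> {1..4} \<Longrightarrow> k \<in> {1..4} \<Longrightarrow> (\<Sum>j\<in>{1..4}. U j i * U j k) = (if i = k then d else 0)"
    and rows: "\<And>i k. i \<in> {1..4} \<Longrightarrow> k \<in> {1..4} \<Longrightarrow> (\<Sum>j\<in>{1..4}. U i j * U k j) = (if i = k then d else 0)"
    and ord: "lam 1 \<ge> lam 2 + lam 3 + lam 4" "lam 2 \<ge> lam 3" "lam 3 \<ge> lam 4" "lam 4 \<ge> 0"
  defines "\<mu> \<equiv> \<lambda>j. \<Sum>i\<in>{1..4}. lam i * (cmod (U j i))\<^sup>2"
  shows "\<mu> 1 - \<mu> 2 - \<mu> 3 - \<mu> 4 \<le> cmod d * (lam 1 - lam 2 - lam 3 - lam 4)"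
    and "cmod d * lam 4 \<le> \<mu> 4"
    and "cmod d * (lam 3 + lam 4) \<le> \<mu> 3 + \<mu> 4"
    and "cmod d * (lam 1 + lam 2 + lam 3 + lam 4) \<le> \<mu> 1 + \<mu> 2 + \<mu> 3 + \<mu> 4"
proof -
  define P where "P = (\<lambda>j i. (cmod (U j i))\<^sup>2)"
  have four1: "{1..4::nat} - {1} = {2,3,4}" and four4: "{1..4::nat} - {4} = {1,2,3}" by auto
  have P0: "P j i \<ge> 0" for i j by (simp add: P_def)
  have cols2: "(\<Sum>j\<in>{1..4}. (U j i)\<^sup>2) = d" if "i \<in> {1..4}" for i
    using cols[OF that that] by (simp add: power2_eq_square)
  have rows2: "(\<Sum>j\<in>{1..4}. (U i j)\<^sup>2) = d" if "i \<in> {1..4}" for i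
    using rows[OF that that] by (simp add: power2_eq_square)
  have col_ge: "cmod d \<le> P 1 i + P 2 i + P 3 i + P 4 i" if "i \<in> {1..4}" for i
    using norm_sum_squares_le[of "\<lambda>j. U j i" "{1..4}"] cols2[OF that] unfolding atLeastAtMost_1_4 by (simp add: P_def)
  have row_ge: "cmod d \<le> P j 1 + P j 2 + P j 3 + P j 4" if "j \<in> {1..4}" for j
    using norm_sum_squares_le[of "U j" "{1..4}"] rows2[OF that] unfolding atLeastAtMost_1_4 by (simp add: P_def)
  have first_col: "P 1 1 - P 2 1 - P 3 1 - P 4 1 \<le> cmod d"
    using isotropic_component_le[of "{1..4}" 1 "\<lambda>j. U j 1"] cols2[of 1] unfolding four1 by (simp add: P_def)
  have pair_cols: "P 1 1 - P 2 1 - P 3 1 - P 4 1 + (P 1 k - P 2 k - P 3 k - P 4 k) \<le> 0" if "k \<in> {2..4}" for k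
    using orthogonal_pair_component_le[of "{1..4}" 1 "\<lambda>j. U j 1" d "\<lambda>j. U j k"]
      cols2[of 1] cols2[of k] cols[of 1 k] that unfolding four1 by (simp add: P_def)
  \<comment> \<open>Rows 3 and 4 form the orthogonal pair; the omitted entry is column 4, which
    carries the smallest weight.\<close>
  have pair_rows: "cmod d \<le> P 3 1 + P 4 1 + (P 3 2 + P 4 2) + (P 3 3 + P 4 3)"
    using orthogonal_pair_sum_ge[of "{1..4}" 4 "U 3" d "U 4"] rows2[of 3] rows2[of 4] rows[of 3 4]
    unfolding four4 by (simp add: P_def)
  have \<mu>: "\<mu> j = lam 1 * P j 1 + lam 2 * P j 2 + lam 3 * P j 3 + lam 4 * P j 4" for j
    unfolding \<mu>_def P_def atLeastAtMost_1_4 by simp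
  define h where "h k = P 1 k - P 2 k - P 3 k - P 4 k" for k
  define r where "r = lam 1 - lam 2 - lam 3 - lam 4"
  have "r * h 1 \<le> r * cmod d"
    using first_col ord by (intro mult_left_mono) (auto simp: h_def r_def)
  moreover have "lam k * (h 1 + h k) \<le> 0" if "k \<in> {2,3,4}" for k
    using that pair_cols[of k] ord by (intro mult_nonneg_nonpos) (auto simp: h_def)
  from this[of 2] this[of 3] this[of 4] have "lam 2 * (h 1 + h 2) \<le> 0" "lam 3 * (h 1 + h 3) \<le> 0" "lam 4 * (h 1 + h 4) \<le> 0"
    by simp_all
  \<comment> \<open>\<open>h k\<close> is the contribution of column \<open>k\<close>. As lam 1 = r
    + lam 2 + lam 3 + lam 4, the share of column 1 is distributed so that each other column is
    paired with it.\<close>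
  moreover have "\<mu> 1 - \<mu> 2 - \<mu> 3 - \<mu> 4 = r * h 1 + lam 2 * (h 1 + h 2) + lam 3 * (h 1 + h 3) + lam 4 * (h 1 + h 4)"
    unfolding \<mu> h_def r_def by (simp add: algebra_simps)
  ultimately show "\<mu> 1 - \<mu> 2 - \<mu> 3 - \<mu> 4 \<le> cmod d * (lam 1 - lam 2 - lam 3 - lam 4)"
    by (simp add: r_def mult.commute)
  have lam4: "lam 4 * cmod d \<le> lam 4 * (P j 1 + P j 2 + P j 3 + P j 4)" if "j \<in> {1..4}" for j
    using row_ge[OF that] ord by (intro mult_left_mono)
  have rest: "(lam i - lam 4) * P j i \<ge> 0" if "i \<in> {1,2,3}" for i j
    using that ord P0 by (intro mult_nonneg_nonneg) auto
  show "cmod d * lam 4 \<le> \<mu> 4"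
    using lam4[of 4] rest[of 1 4] rest[of 2 4] rest[of 3 4] unfolding \<mu> by (simp add: algebra_simps)
  \<comment> \<open>Layers of weights: \<open>lam 4\<close> on all columns,
    \<open>lam 3 - lam 4\<close> on the first three, and the nonnegative
    \<open>lam i - lam 3\<close> on the first two.\<close>
  have lam3: "(lam 3 - lam 4) * cmod d \<le> (lam 3 - lam 4) * (P 3 1 + P 4 1 + (P 3 2 + P 4 2) + (P 3 3 + P 4 3))"
    using pair_rows ord by (intro mult_left_mono) auto
  have rest3: "(lam i - lam 3) * P j i \<ge> 0" if "i \<in> {1,2}" for i j
    using that ord P0 by (intro mult_nonneg_nonneg) auto
  show "cmod d * (lam 3 + lam 4) \<le> \<mu> 3 + \<mu> 4"
    using lam4[of 3] lam4[of 4] lam3 rest3[of 1 3] rest3[of 2 3] rest3[of 1 4] rest3[of 2 4]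
    unfolding \<mu> by (simp add: algebra_simps)
  have "lam i * cmod d \<le> lam i * (P 1 i + P 2 i + P 3 i + P 4 i)" if "i \<in> {1..4}" for i
    using that col_ge[OF that] ord unfolding atLeastAtMost_1_4 by (intro mult_left_mono) auto
  from this[of 1] this[of 2] this[of 3] this[of 4]
  show "cmod d * (lam 1 + lam 2 + lam 3 + lam 4) \<le> \<mu> 1 + \<mu> 2 + \<mu> 3 + \<mu> 4"
    unfolding \<mu> by (simp add: algebra_simps)
qed

section \<open>Bell amplitudes of a local operator\<close>

definition coord :: "nat \<Rightarrow> qvec2 \<Rightarrow> complex" where
  "coord j v = (\<Sum>k\<in>UNIV. cnj (bell j $ k) * v $ k)"

text \<open>Complex bilinear polarisation of the determinant of a vector read as a 2x2 matrix (twice the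
  determinant on the diagonal), which a local operator merely rescales. In the Bell basis it is
  diagonal with entries 1, -1, -1, 1; the phases below are square roots of these entries and so
  turn local operators into multiples of complex orthogonal matrices.\<close>
definition omega :: "qvec2 \<Rightarrow> qvec2 \<Rightarrow> complex" where
  "omega v w = v $ (0,0) * w $ (1,1) + v $ (1,1) * w $ (0,0) - v $ (0,1) * w $ (1,0) - v $ (1,0) * w $ (0,1)"

definition phase :: "nat \<Rightarrow> complex" where
  "phase j = (if j = 2 \<or> j = 3 then \<i> else 1)"

lemma det2: "det (A :: qop) = A $ 0 $ 0 * A $ 1 $ 1 - A $ 0 $ 1 * A $ 1 $ 0"
  unfolding det_2 two_eq_zero by (simp add: algebra_simps)

text \<open>Polarised form of det (A M B^T) = det A det B det M, where M is the vector read as a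
  matrix.\<close>

lemma omega_kron: "omega (kron A B *v v) (kron A B *v w) = det A * det B * omega v w"
  unfolding det2 by (simp add: omega_def kron_def matrix_vector_mult_def sum_pair2 algebra_simps)

lemma omega_coord: "omega v w = (\<Sum>j\<in>{1..4}. (phase j)\<^sup>2 * coord j v * coord j w)"
proof -
  have half: "2 * (1 / complex_of_real (sqrt 2)) * (1 / complex_of_real (sqrt 2)) = 1"
    by (simp add: sqrt2_mult)
  have coords: "coord 1 v = (1 / complex_of_real (sqrt 2)) * (v $ (0,0) + v $ (1,1))"
     "coord 2 v = (1 / complex_of_real (sqrt 2)) * (v $ (0,0) - v $ (1,1))"
     "coord 3 v = (1 / complex_of_real (sqrt 2)) * (v $ (0,1) + v $ (1,0))"
     "coord 4 v = (1 / complex_of_real (sqrt 2)) * (v $ (0,1) - v $ (1,0))" for v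
    by (simp_all add: coord_def sum_pair2 bell_nth algebra_simps)
  have "(\<Sum>j\<in>{1..4}. (phase j)\<^sup>2 * coord j v * coord j w) =
     coord 1 v * coord 1 w - coord 2 v * coord 2 w - coord 3 v * coord 3 w + coord 4 v * coord 4 w"
    unfolding atLeastAtMost_1_4 by (simp add: phase_def)
  then show ?thesis unfolding omega_def coords using half by algebra
qed

lemma coord_bell:
  assumes "i \<in> {1..4}" "j \<in> {1..4}"
  shows "coord j (bell i) = (if i = j then 1 else 0)"
  using assms unfolding atLeastAtMost_1_4 by (auto simp: coord_def sum_pair2 bell_nth sqrt2_mult)

lemma phase_square_square: "(phase j)\<^sup>2 * (phase j)\<^sup>2 = 1"
  by (simp add: phase_def)

lemma omega_bell:
  assumes "i \<in> {1..4}" "k \<in> {1..4}"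
  shows "omega (bell i) (bell k) = (if i = k then (phase i)\<^sup>2 else 0)"
  using assms unfolding omega_coord atLeastAtMost_1_4 by (auto simp: coord_bell)

text \<open>The row phase turns \<open>omega\<close> into the standard bilinear form and the column
  phase normalises the columns. Both have modulus 1, so transition weights are unaffected.\<close>

definition amp :: "qop \<Rightarrow> qop \<Rightarrow> nat \<Rightarrow> nat \<Rightarrow> complex" where
  "amp A B j i = phase j * phase i * coord j (kron A B *v bell i)"

lemma amp_columns:
  assumes "i \<in> {1..4}" "k \<in> {1..4}"
  shows "(\<Sum>j\<in>{1..4}. amp A B j i * amp A B j k) = (if i = k then det A * det B else 0)"
proof -
  have "(\<Sum>j\<in>{1..4}. amp A B j i * amp A B j k)
      = phase i * phase k * omega (kron A B *v bell i) (kron A B *v bell k)"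
    unfolding omega_coord sum_distrib_left by (simp add: amp_def power2_eq_square mult_ac)
  also have "\<dots> = (if i = k then ((phase i)\<^sup>2 * (phase i)\<^sup>2) * (det A * det B) else 0)"
    unfolding omega_kron omega_bell[OF assms] by (simp add: power2_eq_square mult_ac)
  finally show ?thesis unfolding phase_square_square by simp
qed

lemma cnj_bell: "cnj (bell j $ k) = bell j $ k"
  by (simp add: bell_def ket_def)

text \<open>Bell vectors are real, so transposing the local operators transposes the matrix. This
  yields the row relations even when d = 0, where they do not follow from the column
  relations.\<close>

lemma amp_transpose: "amp A B j i = amp (transpose A) (transpose B) i j"
proof -
  have "coord j (kron A B *v bell i) = coord i (kron (transpose A) (transpose B) *v bell j)"
    by (simp add: coord_def cnj_bell matrix_vector_mult_def kron_def transpose_def sum_pair2 algebra_simps)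
  then show ?thesis by (simp add: amp_def)
qed

lemma amp_rows:
  assumes "i \<in> {1..4}" "k \<in> {1..4}"
  shows "(\<Sum>j\<in>{1..4}. amp A B i j * amp A B k j) = (if i = k then det A * det B else 0)"
  using amp_columns[OF assms, of "transpose A" "transpose B"]
  by (simp only: amp_transpose[symmetric] det_transpose)

text \<open>The diagonal entry in the Bell basis. It is linear, so a SLOCC identity can be read
  entrywise although its individual summands need not be Bell-diagonal.\<close>

definition fid :: "nat \<Rightarrow> qop2 \<Rightarrow> real" where
  "fid j X = Re (\<Sum>k\<in>UNIV. \<Sum>l\<in>UNIV. cnj (bell j $ k) * X $ k $ l * bell j $ l)"

lemma fid_add: "fid j (X + Y) = fid j X + fid j Y"
  by (simp add: fid_def algebra_simps sum.distrib)

lemma fid_scaleR: "fid j (r *\<^sub>R X) = r * fid j X"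
  by (simp add: fid_def sum_distrib_left)

lemma fid_sum: "fid j (\<Sum>i\<in>I. f i) = (\<Sum>i\<in>I. fid j (f i))"
  by (induction I rule: infinite_finite_induct) (simp_all add: fid_add, simp_all add: fid_def)

lemma fid_proj: "fid j (proj v) = (cmod (coord j v))\<^sup>2"
proof -
  have "(\<Sum>k\<in>UNIV. \<Sum>l\<in>UNIV. cnj (bell j $ k) * proj v $ k $ l * bell j $ l) = coord j v * cnj (coord j v)"
    by (simp add: coord_def proj_def sum_product mult_ac)
  then show ?thesis unfolding fid_def by (simp add: complex_mult_cnj cmod_power2)
qed

lemma fid_bell_diag:
  assumes "j \<in> {1..4}" shows "fid j (bell_diag lam) = lam j"
proof -
  have "fid j (bell_diag lam) = (\<Sum>i\<in>{1..4}. if i = j then lam i else 0)"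
    unfolding bell_diag_def fid_sum fid_scaleR fid_proj
    by (rule sum.cong) (simp_all only: coord_bell[OF _ assms], simp)
  then show ?thesis using assms by simp
qed

lemma fid_local_op:
  "fid j (local_op A B (bell_diag lam)) = (\<Sum>i\<in>{1..4}. lam i * (cmod (amp A B j i))\<^sup>2)"
proof -
  have "cmod (amp A B j i) = cmod (coord j (kron A B *v bell i))" for i
    by (simp add: amp_def norm_mult phase_def)
  then show ?thesis
    unfolding bell_diag_def local_op_sum local_op_scaleR local_op_proj fid_sum fid_scaleR fid_proj by simp
qed

section \<open>Reachable weights and separable states\<close>

lemma reach_swap34: "reach \<rho> (bdiag a b c d) \<Longrightarrow> reach \<rho> (bdiag a b d c)"
  by (metis reach_local_op local_op_swap34)

lemma reach_swap23: "reach \<rho> (bdiag a b c d) \<Longrightarrow> reach \<rho> (bdiag a c b d)"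
  by (metis reach_local_op local_op_swap23)

lemma reach_swap13_24: "reach \<rho> (bdiag a b c d) \<Longrightarrow> reach \<rho> (bdiag c d a b)"
  by (metis reach_local_op local_op_swap13_24)

lemma reach_bdiag_add:
  "reach \<rho> (bdiag a b c d) \<Longrightarrow> reach \<rho> (bdiag a' b' c' d') \<Longrightarrow> reach \<rho> (bdiag (a + a') (b + b') (c + c') (d + d'))"
  using reach_add[of \<rho> "bdiag a b c d" "bdiag a' b' c' d'"] by (simp add: bdiag_def algebra_simps)

lemma reach_bdiag_scale:
  "reach \<rho> (bdiag a b c d) \<Longrightarrow> r \<ge> 0 \<Longrightarrow> reach \<rho> (bdiag (r * a) (r * b) (r * c) (r * d))"
  using reach_scaleR[of \<rho> "bdiag a b c d" r] by (simp add: bdiag_def algebra_simps)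

lemma reach_transfer23:
  assumes "reach \<rho> (bdiag a b c d)" "0 \<le> e" "e \<le> b - c"
  shows "reach \<rho> (bdiag a (b - e) (c + e) d)"
proof (cases "b = c")
  case False
  \<comment> \<open>Mixing the state with its swapped copy in proportion \<open>t\<close> moves t (b
    - c) = e from \<open>b\<close> to \<open>c\<close>; if b = c then e = 0.\<close>
  define t where "t = e / (b - c)"
  have t: "0 \<le> t" "t \<le> 1" and e: "e = t * (b - c)" using assms False by (auto simp: t_def)
  have "reach \<rho> (bdiag ((1 - t) * a + t * a) ((1 - t) * b + t * c) ((1 - t) * c + t * b) ((1 - t) * d + t * d))"
    using t by (intro reach_bdiag_add reach_bdiag_scale assms reach_swap23[OF assms(1)]) auto
  then show ?thesis unfolding e by (simp add: algebra_simps)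
qed (use assms in simp)

lemma reach_transfer24:
  assumes "reach \<rho> (bdiag a b c d)" "0 \<le> e" "e \<le> b - d"
  shows "reach \<rho> (bdiag a (b - e) c (d + e))"
  by (rule reach_swap34[OF reach_transfer23[OF reach_swap34[OF assms(1)] assms(2,3)]])

lemma reach_transfer34:
  assumes "reach \<rho> (bdiag a b c d)" "0 \<le> e" "e \<le> c - d"
  shows "reach \<rho> (bdiag a b (c - e) (d + e))"
  by (rule reach_swap23[OF reach_transfer24[OF reach_swap23[OF assms(1)] assms(2,3)]])

text \<open>At most two transfers lead from a vector to one that it majorizes in dimension 3.\<close>
lemma reach_majorized:
  assumes "reach \<rho> (bdiag a b c d)"
    and "u \<ge> v" "v \<ge> w" "u + v + w = b + c + d" "u \<le> b" "w \<ge> d"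
  shows "reach \<rho> (bdiag a u v w)"
\<comment> \<open>If the middle entry has to grow, \<open>b\<close> gives to both others; otherwise
  \<open>b\<close> and \<open>c\<close> both give to \<open>d\<close>.\<close>
proof (cases "v \<ge> c")
  case True
  have "reach \<rho> (bdiag a (b - (v - c)) (c + (v - c)) d)"
    using True assms by (intro reach_transfer23[OF assms(1)]) auto
  then have "reach \<rho> (bdiag a (b - (v - c) - (w - d)) (c + (v - c)) (d + (w - d)))"
    by (rule reach_transfer24) (use assms in auto)
  moreover have "b - (v - c) - (w - d) = u" using assms by simp
  ultimately show ?thesis by simp
next
  case False
  have "reach \<rho> (bdiag a b (c - (c - v)) (d + (c - v)))"
    using False assms by (intro reach_transfer34[OF assms(1)]) auto
  then have "reach \<rho> (bdiag a (b - (b - u)) (c - (c - v)) (d + (c - v) + (b - u)))"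
    by (rule reach_transfer24) (use assms in auto)
  moreover have "d + (c - v) + (b - u) = w" using assms by simp
  ultimately show ?thesis by simp
qed

text \<open>Cap (x, y, z) at the level that brings its sum down to that of (b, c, d). The cases are
  whether the cap lowers only \<open>x\<close>, levels \<open>x\<close> and \<open>y\<close>, or
  levels all three; the result is majorized by (b, c, d).\<close>

lemma truncate_triple:
  fixes x y z b c d :: real
  assumes "x \<ge> y" "y \<ge> z" "b \<ge> c" "c \<ge> d"
    and "z \<ge> d" "y + z \<ge> c + d" "x + y + z \<ge> b + c + d"
  obtains u v w where "u \<le> x" "v \<le> y" "w \<le> z" "u \<ge> v" "v \<ge> w" "u + v + w = b + c + d" "u \<le> b" "w \<ge> d"
proof -
  define S where "S = b + c + d"
  consider "S \<ge> 2 * y + z" | "S < 2 * y + z" "S \<ge> 3 * z" | "S < 3 * z" by linarith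
  then show ?thesis
  proof cases
    case 1
    then show ?thesis using assms by (intro that[of "S - y - z" y z]) (auto simp: S_def)
  next
    case 2
    then show ?thesis using assms by (intro that[of "(S - z) / 2" "(S - z) / 2" z]) (auto simp: S_def)
  next
    case 3
    \<comment> \<open>The common level S / 3, introduced by a linear equation suited to
      \<open>linarith\<close>.\<close>
    obtain m where m: "3 * m = S" by (metis nonzero_mult_div_cancel_left times_divide_eq_right zero_neq_numeral)
    show ?thesis
      by (rule that[of m m m]) (use 3 m assms S_def in linarith)+
  qed
qed

text \<open>The weights are a nonnegative combination of (1,1,0,0), (1,0,1,0) and (1,0,0,1). The
  first equals the sum of the other three, so adding such an operator never changes D.\<close>

lemma reach_separable:
  assumes "reach \<rho> (proj (ket 0 0))" "b \<ge> 0" "c \<ge> 0" "d \<ge> 0"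
  shows "reach \<rho> (bdiag (b + c + d) b c d)"
proof -
  have 1: "reach \<rho> (bdiag 1 1 0 0)"
    using reach_add[OF assms(1) reach_local_op[OF assms(1)]] by (metis proj_ket_sum)
  have 2: "reach \<rho> (bdiag 1 0 1 0)" by (rule reach_swap23[OF 1])
  have 3: "reach \<rho> (bdiag 1 0 0 1)" by (rule reach_swap34[OF 2])
  have "reach \<rho> (bdiag (b * 1 + c * 1 + d * 1) (b * 1 + c * 0 + d * 0) (b * 0 + c * 1 + d * 0) (b * 0 + c * 0 + d * 1))"
    using assms(2-4) by (intro reach_bdiag_add reach_bdiag_scale 1 2 3)
  then show ?thesis by simp
qed

lemma reach_bdiag:
  assumes pos: "l2 \<ge> l3" "l3 \<ge> l4" "l4 \<ge> 0" "l1 > l2 + l3 + l4"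
    and pos': "l2' \<ge> l3'" "l3' \<ge> l4'" "l4' \<ge> 0" "l1' > l2' + l3' + l4'"
    and D: "D = l1 - l2 - l3 - l4" "D' = l1' - l2' - l3' - l4'"
    and le: "D' * (l2 + l3 + l4) \<le> D * (l2' + l3' + l4')" "D' * (l3 + l4) \<le> D * (l3' + l4')" "D' * l4 \<le> D * l4'"
  shows "reach (bdiag l1 l2 l3 l4) (bdiag l1' l2' l3' l4')"
proof -
  let ?\<rho> = "bdiag l1 l2 l3 l4"
  \<comment> \<open>Scaling the source by \<open>r\<close> makes its D equal to
    \<open>D'\<close>.\<close>
  define r where "r = D' / D"
  have Dpos: "D > 0" "D' > 0" using pos pos' D by auto
  then have r: "r > 0" by (simp add: r_def)
  have le': "r * l2 + r * l3 + r * l4 \<le> l2' + l3' + l4'" "r * l3 + r * l4 \<le> l3' + l4'" "r * l4 \<le> l4'"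
    using le Dpos by (simp_all add: r_def field_simps)
  obtain u v w where uvw: "u \<le> l2'" "v \<le> l3'" "w \<le> l4'" "u \<ge> v" "v \<ge> w"
      "u + v + w = r * l2 + r * l3 + r * l4" "u \<le> r * l2" "w \<ge> r * l4"
    using truncate_triple[of l3' l2' l4' "r * l3" "r * l2" "r * l4", OF pos'(1,2)] pos le' r
    by (metis less_imp_le mult_left_mono)
  have "reach ?\<rho> (bdiag (r * l1) (r * l2) (r * l3) (r * l4))"
    using r by (intro reach_bdiag_scale reach_refl) simp
  then have 1: "reach ?\<rho> (bdiag (r * l1) u v w)"
    by (rule reach_majorized) (use uvw in auto)
  have l12: "l1 + l2 > 0" using pos by linarith
  have "reach ?\<rho> (((l1 + l2) / 2) *\<^sub>R proj (ket 0 0))"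
    by (metis reach_local_op[OF reach_refl] local_op_product)
  from reach_scaleR[OF this, of "2 / (l1 + l2)"]
  have "reach ?\<rho> ((2 / (l1 + l2) * ((l1 + l2) / 2)) *\<^sub>R proj (ket 0 0))"
    using l12 by (simp only: scaleR_scaleR) simp
  moreover have "2 / (l1 + l2) * ((l1 + l2) / 2) = 1" using l12 by simp
  ultimately have "reach ?\<rho> (proj (ket 0 0))" by (simp only: scaleR_one)
  \<comment> \<open>The missing weights are supplied by a separable operator; since it has D = 0,
    the first weight then comes out right as well.\<close>
  then have "reach ?\<rho> (bdiag ((l2' - u) + (l3' - v) + (l4' - w)) (l2' - u) (l3' - v) (l4' - w))"
    using uvw by (intro reach_separable) auto
  from reach_bdiag_add[OF 1 this]
  have "reach ?\<rho> (bdiag (r * l1 + ((l2' - u) + (l3' - v) + (l4' - w))) l2' l3' l4')" by simp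
  moreover have "r * D = D'" using Dpos by (simp add: r_def)
  then have "r * l1 + ((l2' - u) + (l3' - v) + (l4' - w)) = l1'"
    using uvw D by (simp add: algebra_simps)
  ultimately show ?thesis by simp
qed

lemma reach_not_entangled:
  assumes "reach \<rho> (proj (ket 0 0))" "a \<ge> b" "b \<ge> c" "c \<ge> d" "d \<ge> 0" "a \<le> b + c + d"
  shows "reach \<rho> (bdiag a b c d)"
proof -
  \<comment> \<open>Removing (0, e, e, 0) with this \<open>e\<close> makes the first weight exactly
    the sum of the remaining three, as \<open>reach_separable\<close> requires.\<close>
  define e where "e = (b + c + d - a) / 2"
  have e: "0 \<le> e" "e \<le> c" "e \<le> b" using assms by (auto simp: e_def)
  have "reach \<rho> (bdiag (0 + e + 0) 0 0 e)"
    using reach_separable[OF assms(1), of 0 0 e] e by simp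
  then have "reach \<rho> (bdiag 0 e e 0)"
    using reach_swap13_24 by fastforce
  moreover have "reach \<rho> (bdiag ((b - e) + (c - e) + d) (b - e) (c - e) d)"
    using assms e by (intro reach_separable) auto
  ultimately have "reach \<rho> (bdiag (0 + ((b - e) + (c - e) + d)) (e + (b - e)) (e + (c - e)) (0 + d))"
    by (rule reach_bdiag_add)
  moreover have "(b - e) + (c - e) + d = a" by (simp add: e_def)
  ultimately show ?thesis by simp
qed

section \<open>Product decompositions and separability\<close>

definition outer :: "complex ^ 2 \<Rightarrow> qop" where
  "outer a = (\<chi> i j. a $ i * cnj (a $ j))"

definition sq_norm :: "complex ^ 2 \<Rightarrow> real" where
  "sq_norm a = (cmod (a $ 0))\<^sup>2 + (cmod (a $ 1))\<^sup>2"

text \<open>A null vector gets an arbitrary pure state, because \<open>separable\<close> asks for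
  density matrices even where the weight is zero.\<close>

definition normalized_outer :: "complex ^ 2 \<Rightarrow> qop" where
  "normalized_outer a = (if sq_norm a = 0 then outer (axis 0 1) else (1 / sq_norm a) *\<^sub>R outer a)"

lemma sq_norm_scaleR_normalized_outer: "sq_norm a *\<^sub>R normalized_outer a = outer a"
proof (cases "sq_norm a = 0")
  case True
  then have "a = 0"
    by (simp add: sq_norm_def vec_eq_iff all_two_zero_one add_nonneg_eq_0_iff)
  then show ?thesis using True by (simp add: outer_def vec_eq_iff)
qed (simp add: normalized_outer_def)

lemma psd_outer: "r \<ge> 0 \<Longrightarrow> psd (r *\<^sub>R outer a)"
proof -
  assume "r \<ge> 0"
  \<comment> \<open>The quadratic form is \<open>r\<close> times the squared modulus of the inner
    product of \<open>a\<close> and \<open>x\<close>.\<close>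
  have q: "(\<Sum>i\<in>UNIV. cnj (x $ i) * (r *\<^sub>R outer a *v x) $ i)
      = of_real (r * (cmod (\<Sum>i\<in>UNIV. cnj (a $ i) * x $ i))\<^sup>2)" for x
    unfolding of_real_mult complex_norm_square
    by (simp add: matrix_vector_mult_def outer_def sum_two_zero_one scaleR_conv_of_real[of _ "_::complex"] algebra_simps)
  show ?thesis
    unfolding psd_def q using \<open>r \<ge> 0\<close>
    by (simp add: hermitian_def cadj_def outer_def vec_eq_iff)
qed

lemma trace_outer: "trace_c (outer a) = of_real (sq_norm a)"
  by (simp add: trace_c_def outer_def sum_two_zero_one sq_norm_def complex_norm_square flip: of_real_power)

lemma density_normalized_outer: "density (normalized_outer a)"
proof -
  have 1: "density ((1 / sq_norm a) *\<^sub>R outer a)" if "sq_norm a \<noteq> 0" for a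
  proof -
    have "sq_norm a \<ge> 0" by (simp add: sq_norm_def)
    moreover have "trace_c ((1 / sq_norm a) *\<^sub>R outer a) = (1 / sq_norm a) *\<^sub>R trace_c (outer a)"
      by (simp add: trace_c_def scaleR_sum_right)
    ultimately show ?thesis using that psd_outer[of "1 / sq_norm a" a]
      by (simp add: density_def trace_outer scaleR_conv_of_real)
  qed
  have "sq_norm (axis 0 1) = 1" by (simp add: sq_norm_def axis_def)
  with 1[of "axis 0 1"] 1[of a] show ?thesis by (simp add: normalized_outer_def)
qed

lemma trace_kron: "trace_c (kron A B) = trace_c A * trace_c B"
  by (simp add: trace_c_def kron_def sum_pair2 sum_two_zero_one algebra_simps)

lemma kron_scaleR: "kron (r *\<^sub>R A) (s *\<^sub>R B) = (r * s) *\<^sub>R kron A B"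
  by (simp add: kron_def vec_eq_iff)

lemma trace_sum: "trace_c (\<Sum>i\<in>I. f i) = (\<Sum>i\<in>I. trace_c (f i))"
  unfolding trace_c_def sum_component by (rule sum.swap)

lemma local_op_product_state:
  "local_op A B (proj (ket 0 0)) = kron (outer (column 0 A)) (outer (column 0 B))"
  unfolding local_op_proj
  by (simp add: vec_pair_eq_iff proj_def kron_def outer_def column_def ket_def
      matrix_vector_mult_def sum_pair2 mult_ac)

text \<open>Local operators send |00> to unnormalised product vectors. Their squared norms become
  the weights, and the trace condition makes these sum to 1.\<close>

lemma separable_if_reach:
  assumes "reach (proj (ket 0 0)) \<sigma>" "trace_c \<sigma> = 1"
  shows "separable \<sigma>"
proof -
  obtain n :: nat and A B where "(\<Sum>i<n. local_op (A i) (B i) (proj (ket 0 0))) = \<sigma>"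
    using assms(1) unfolding reach_def by blast
  then have \<sigma>: "\<sigma> = (\<Sum>i<n. kron (outer (column 0 (A i))) (outer (column 0 (B i))))"
    by (simp add: local_op_product_state)
  define p where "p i = sq_norm (column 0 (A i)) * sq_norm (column 0 (B i))" for i
  have "\<sigma> = (\<Sum>i<n. p i *\<^sub>R kron (normalized_outer (column 0 (A i))) (normalized_outer (column 0 (B i))))"
    by (simp add: \<sigma> p_def sq_norm_scaleR_normalized_outer flip: kron_scaleR)
  moreover have "trace_c \<sigma> = of_real (\<Sum>i<n. p i)"
    by (simp add: \<sigma> trace_sum trace_kron trace_outer p_def)
  then have "(\<Sum>i<n. p i) = 1"
    using assms(2) by (metis of_real_eq_1_iff)
  moreover have "p i \<ge> 0" for i by (simp add: p_def sq_norm_def)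
  ultimately show ?thesis
    unfolding separable_def
    by (intro exI[of _ n] exI[of _ p] exI[of _ "\<lambda>i. normalized_outer (column 0 (A i))"]
        exI[of _ "\<lambda>i. normalized_outer (column 0 (B i))"]) (simp add: density_normalized_outer)
qed

section \<open>The SLOCC criterion\<close>

text \<open>Positive numerators make cross-multiplication agree with the convention for zero
  denominators.\<close>

lemma ediv_le_iff:
  assumes "a > 0" "a' > 0" "b \<ge> 0" "b' \<ge> 0"
  shows "ediv a b \<ge> ediv a' b' \<longleftrightarrow> a' * b \<le> a * b'"
  using assms by (auto simp: ediv_def field_simps mult_le_0_iff)

lemma trace_proj_bell: "trace_c (proj (bell i)) = 1"
  by (simp add: trace_c_def proj_def bell_def ket_def sum_pair2 flip: of_real_mult)

lemma entangled_bell_diag: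
  assumes "entangled (bell_diag lam)" "(\<Sum>i\<in>{1..4}. lam i) = 1"
    and "lam 1 \<ge> lam 2" "lam 2 \<ge> lam 3" "lam 3 \<ge> lam 4" "lam 4 \<ge> 0"
  shows "lam 1 > lam 2 + lam 3 + lam 4"
proof (rule ccontr)
  assume "\<not> ?thesis"
  then have "reach (proj (ket 0 0)) (bell_diag lam)"
    unfolding bell_diag_eq using assms by (intro reach_not_entangled reach_refl) auto
  moreover have "trace_c (bell_diag lam) = of_real (\<Sum>i\<in>{1..4}. lam i)"
    unfolding bell_diag_def trace_sum
    by (simp add: trace_proj_bell trace_c_def[of "_ *\<^sub>R _"] flip: scaleR_sum_right trace_c_def)
       (simp add: scaleR_conv_of_real)
  then have "trace_c (bell_diag lam) = 1" by (simp only: assms(2) of_real_1)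
  ultimately show False
    using separable_if_reach assms(1) unfolding entangled_def by blast
qed

lemma slocc_weights:
  fixes lam lam' :: "nat \<Rightarrow> real"
  assumes "slocc (bell_diag lam) (bell_diag lam')"
    and "lam 1 \<ge> lam 2 + lam 3 + lam 4" "lam 2 \<ge> lam 3" "lam 3 \<ge> lam 4" "lam 4 \<ge> 0"
  obtains \<delta> where "\<delta> \<ge> 0"
    "lam' 1 - lam' 2 - lam' 3 - lam' 4 \<le> \<delta> * (lam 1 - lam 2 - lam 3 - lam 4)"
    "\<delta> * lam 4 \<le> lam' 4" "\<delta> * (lam 3 + lam 4) \<le> lam' 3 + lam' 4"
    "\<delta> * (lam 1 + lam 2 + lam 3 + lam 4) \<le> lam' 1 + lam' 2 + lam' 3 + lam' 4"
proof -
  obtain n :: nat and A B c where c: "c > 0"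
    and eq: "(\<Sum>m<n. local_op (A m) (B m) (bell_diag lam)) = c *\<^sub>R bell_diag lam'"
    using assms(1) unfolding slocc_def local_op_def by blast
  define \<mu> where "\<mu> = (\<lambda>m j. \<Sum>i\<in>{1..4}. lam i * (cmod (amp (A m) (B m) j i))\<^sup>2)"
  define d where "d = (\<lambda>m. cmod (det (A m) * det (B m)))"
  note w = orthogonal_weights[of "amp (A m) (B m)" "det (A m) * det (B m)" lam for m,
      OF amp_columns amp_rows assms(2-5), folded \<mu>_def[THEN fun_cong, THEN fun_cong] d_def[THEN fun_cong]]
  have sum: "(\<Sum>m<n. \<mu> m j) = c * lam' j" if "j \<in> {1..4}" for j
    using arg_cong[OF eq, of "fid j"] fid_bell_diag[OF that]
    by (simp only: fid_sum fid_scaleR fid_local_op \<mu>_def)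
  have s: "(\<Sum>m<n. \<mu> m 1) = c * lam' 1" "(\<Sum>m<n. \<mu> m 2) = c * lam' 2"
    "(\<Sum>m<n. \<mu> m 3) = c * lam' 3" "(\<Sum>m<n. \<mu> m 4) = c * lam' 4"
    by (rule sum; simp)+
  \<comment> \<open>The total of the |det A det B|, normalised by \<open>c\<close>: one factor that
    serves all four summed inequalities.\<close>
  define \<delta> where "\<delta> = (\<Sum>m<n. d m) / c"
  have d: "(\<Sum>m<n. d m) = c * \<delta>" using c by (simp add: \<delta>_def)
  show ?thesis
  proof
    show "\<delta> \<ge> 0" using c by (auto simp: \<delta>_def d_def intro!: divide_nonneg_pos sum_nonneg)
    have "(\<Sum>m<n. \<mu> m 1 - \<mu> m 2 - \<mu> m 3 - \<mu> m 4) \<le> (\<Sum>m<n. d m * (lam 1 - lam 2 - lam 3 - lam 4))"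
      by (intro sum_mono w)
    then have "c * (lam' 1 - lam' 2 - lam' 3 - lam' 4) \<le> c * (\<delta> * (lam 1 - lam 2 - lam 3 - lam 4))"
      unfolding sum_subtractf sum_distrib_right[symmetric] s d by (simp only: right_diff_distrib mult.assoc)
    then show "lam' 1 - lam' 2 - lam' 3 - lam' 4 \<le> \<delta> * (lam 1 - lam 2 - lam 3 - lam 4)"
      using c by simp
    have "(\<Sum>m<n. d m * lam 4) \<le> (\<Sum>m<n. \<mu> m 4)" by (intro sum_mono w)
    then have "c * (\<delta> * lam 4) \<le> c * lam' 4"
      unfolding sum_distrib_right[symmetric] s d by (simp only: mult.assoc)
    then show "\<delta> * lam 4 \<le> lam' 4" using c by simp
    have "(\<Sum>m<n. d m * (lam 3 + lam 4)) \<le> (\<Sum>m<n. \<mu> m 3 + \<mu> m 4)" by (intro sum_mono w)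
    then have "c * (\<delta> * (lam 3 + lam 4)) \<le> c * (lam' 3 + lam' 4)"
      unfolding sum.distrib sum_distrib_right[symmetric] s d by (simp only: mult.assoc distrib_left)
    then show "\<delta> * (lam 3 + lam 4) \<le> lam' 3 + lam' 4" using c by simp
    have "(\<Sum>m<n. d m * (lam 1 + lam 2 + lam 3 + lam 4)) \<le> (\<Sum>m<n. \<mu> m 1 + \<mu> m 2 + \<mu> m 3 + \<mu> m 4)"
      by (intro sum_mono w)
    then have "c * (\<delta> * (lam 1 + lam 2 + lam 3 + lam 4)) \<le> c * (lam' 1 + lam' 2 + lam' 3 + lam' 4)"
      unfolding sum.distrib sum_distrib_right[symmetric] s d by (simp only: mult.assoc distrib_left)
    then show "\<delta> * (lam 1 + lam 2 + lam 3 + lam 4) \<le> lam' 1 + lam' 2 + lam' 3 + lam' 4" using c by simp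
  qed
qed

theorem theorem2:
  fixes lam lam' :: "nat \<Rightarrow> real"
  assumes "\<forall>i\<in>{1..4}. lam i \<ge> 0" and "(\<Sum>i\<in>{1..4}. lam i) = 1"
    and "\<forall>i\<in>{1..4}. lam' i \<ge> 0" and "(\<Sum>i\<in>{1..4}. lam' i) = 1"
    and "lam 1 \<ge> lam 2" "lam 2 \<ge> lam 3" "lam 3 \<ge> lam 4"
    and "lam' 1 \<ge> lam' 2" "lam' 2 \<ge> lam' 3" "lam' 3 \<ge> lam' 4"
    and "entangled (bell_diag lam)" and "entangled (bell_diag lam')"
  shows "slocc (bell_diag lam) (bell_diag lam') \<longleftrightarrow>
    (E1 lam \<ge> E1 lam' \<and> E2 lam \<ge> E2 lam' \<and> E3 lam \<ge> E3 lam')"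
proof -
  have l4: "lam 4 \<ge> 0" "lam' 4 \<ge> 0" using assms(1,3) by auto
  have ent: "lam 1 > lam 2 + lam 3 + lam 4" "lam' 1 > lam' 2 + lam' 3 + lam' 4"
    using entangled_bell_diag assms l4 by blast+
  have sums: "lam 1 = 1 - lam 2 - lam 3 - lam 4" "lam' 1 = 1 - lam' 2 - lam' 3 - lam' 4"
    using assms(2,4) unfolding atLeastAtMost_1_4 by simp_all
  define D D' where "D = lam 1 - lam 2 - lam 3 - lam 4" and "D' = lam' 1 - lam' 2 - lam' 3 - lam' 4"
  note D = D_def D'_def
  have Dpos: "D > 0" "D' > 0" using ent by (simp_all add: D)
  \<comment> \<open>All three conditions compare \<open>S / D\<close> for \<open>S = 1 - lam 1\<close>, \<open>lam 3 + lam 4\<close>, \<open>lam 4\<close>.\<close>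
  have E: "E1 lam \<ge> E1 lam' \<longleftrightarrow> D' * (lam 2 + lam 3 + lam 4) \<le> D * (lam' 2 + lam' 3 + lam' 4)"
    "E2 lam \<ge> E2 lam' \<longleftrightarrow> D' * (lam 3 + lam 4) \<le> D * (lam' 3 + lam' 4)"
    "E3 lam \<ge> E3 lam' \<longleftrightarrow> D' * lam 4 \<le> D * lam' 4"
  proof -
    \<comment> \<open>With S = 1 - lam 1 and D = 1 - 2 S the products S S' cancel, leaving S <=
      S'.\<close>
    show "E1 lam \<ge> E1 lam' \<longleftrightarrow> D' * (lam 2 + lam 3 + lam 4) \<le> D * (lam' 2 + lam' 3 + lam' 4)"
      unfolding E1_def D sums by (simp add: algebra_simps)
    \<comment> \<open>So \<open>E2\<close> is D / S + 2 with S = lam 3 + lam 4 when S is nonzero;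
      \<open>E3\<close> is treated likewise with S = lam 4.\<close>
    have num2: "1 - 2 * lam 2 = D + 2 * (lam 3 + lam 4)" "1 - 2 * lam' 2 = D' + 2 * (lam' 3 + lam' 4)"
      unfolding D sums by simp_all
    show "E2 lam \<ge> E2 lam' \<longleftrightarrow> D' * (lam 3 + lam 4) \<le> D * (lam' 3 + lam' 4)"
      unfolding E2_def num2 using Dpos l4 assms(5-10) by (subst ediv_le_iff) (auto simp: algebra_simps)
    have num3: "1 - 2 * lam 2 - 2 * lam 3 = D + 2 * lam 4" "1 - 2 * lam' 2 - 2 * lam' 3 = D' + 2 * lam' 4"
      unfolding D sums by simp_all
    show "E3 lam \<ge> E3 lam' \<longleftrightarrow> D' * lam 4 \<le> D * lam' 4"
      unfolding E3_def num3 using Dpos l4 by (subst ediv_le_iff) (auto simp: algebra_simps)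
  qed
  show ?thesis unfolding E
  proof
    assume "slocc (bell_diag lam) (bell_diag lam')"
    then obtain \<delta> where \<delta>: "\<delta> \<ge> 0" "D' \<le> \<delta> * D" "\<delta> * lam 4 \<le> lam' 4" "\<delta> * (lam 3 + lam 4) \<le> lam' 3 + lam' 4"
        "\<delta> * (lam 1 + lam 2 + lam 3 + lam 4) \<le> lam' 1 + lam' 2 + lam' 3 + lam' 4"
      unfolding D by (rule slocc_weights[OF _ less_imp_le[OF ent(1)] assms(6,7) l4(1)])
    \<comment> \<open>Both bounds pass through \<delta>, which is thereby eliminated.\<close>
    have le: "D' * x \<le> D * y" if "x \<ge> 0" "\<delta> * x \<le> y" for x y
    proof -
      have "D' * x \<le> (\<delta> * D) * x" using \<delta>(2) that(1) by (rule mult_right_mono)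
      also have "\<dots> = D * (\<delta> * x)" by simp
      also have "\<dots> \<le> D * y" using that(2) Dpos by (simp add: mult_left_mono)
      finally show ?thesis .
    qed
    \<comment> \<open>Twice this sum is the trace minus D: the trace bound and the bound on D
      combine.\<close>
    have "\<delta> * (lam 2 + lam 3 + lam 4) \<le> lam' 2 + lam' 3 + lam' 4"
      using \<delta>(2,5) by (simp add: D algebra_simps)
    then show "D' * (lam 2 + lam 3 + lam 4) \<le> D * (lam' 2 + lam' 3 + lam' 4) \<and>
        D' * (lam 3 + lam 4) \<le> D * (lam' 3 + lam' 4) \<and> D' * lam 4 \<le> D * lam' 4"
      using \<delta> l4 assms(5-7) by (intro conjI le) auto
  next
    assume "D' * (lam 2 + lam 3 + lam 4) \<le> D * (lam' 2 + lam' 3 + lam' 4) \<and>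
        D' * (lam 3 + lam 4) \<le> D * (lam' 3 + lam' 4) \<and> D' * lam 4 \<le> D * lam' 4"
    then have "reach (bell_diag lam) (1 *\<^sub>R bell_diag lam')"
      unfolding bell_diag_eq scaleR_one using ent l4 assms(6,7,9,10)
      by (intro reach_bdiag[OF _ _ _ _ _ _ _ _ D]) auto
    then show "slocc (bell_diag lam) (bell_diag lam')"
      unfolding slocc_iff_reach by (meson zero_less_one)
  qed
qed

end
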